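(* Let $n\ge2$. There is a constant $C_n>0$ depending only on $n$ such that the following holds. Let $E,E_1,E_2\subset\mathbb{R}^n$ be measurable sets of positive finite measure with $E\supset E_1\cup E_2$, $E_1\cap E_2=\varnothing$ and $|E_1|\ge|E_2|$. Then $$\frac{|E|D(E)^{\frac n{n-1}}+|E_1|D(E_1)^{\frac n{n-1}}+|E_2|D(E_2)^{\frac n{n-1}}}{|E|+|E_1\cup E_2|}\ \ge\ C_n\left(\frac{|E_2|}{|E_1|+|E_2|}\right)^{\frac n{n-1}}\left(\frac{(|E_1|^{\frac1n}+|E_2|^{\frac1n})^n-|E|}{(|E_1|^{\frac1n}+|E_2|^{\frac1n})^n-|E_1\cup E_2|}\right)_+^{\frac{n(n+1)}{2(n-1)}} ,$$ where $t_+:=\max\{0,t\}$ is applied to the quotient before taking the power.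
   Context: $|\cdot|$ is Lebesgue measure on $\mathbb{R}^n$. The Fraenkel asymmetry of a measurable set $E\subset\mathbb{R}^n$ with $0<|E|<\infty$ is $D(E):=\min_{x\in\mathbb{R}^n}\frac{|E\triangle B(x,r_E)|}{|E|}$, where $r_E$ is such that $|B(x,r_E)|=|E|$, and $\triangle$ denotes symmetric difference. *)

theory Defs
  imports "HOL-Analysis.Analysis"
begin

text \<open>
  The volume radius \<open>r_E\<close>. The lemma \<open>ball_radius_ex1\<close> below shows that it exists and is unique
  for every set of positive finite measure.
\<close>

definition ball_radius :: "(real ^ 'n) set \<Rightarrow> real" where
  "ball_radius E = (THE r. 0 < r \<and> (\<forall>x :: real ^ 'n. measure lebesgue (ball x r) = measure lebesgue E))"

text \<open>
  The minimum over all centres is rendered as an infimum, because \<open>Min\<close> is restricted to finite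
  sets; \<open>fraenkel_asymmetry_is_minimum\<close> shows that the infimum is attained.
\<close>

definition fraenkel_asymmetry :: "(real ^ 'n) set \<Rightarrow> real" where
  "fraenkel_asymmetry E =
     (INF x. measure lebesgue (sym_diff E (ball x (ball_radius E))) / measure lebesgue E)"

lemma ball_radius_ex1:
  fixes E :: "(real ^ 'n) set"
  assumes "measure lebesgue E > 0"
  shows "\<exists>!r. 0 < r \<and> (\<forall>x :: real ^ 'n. measure lebesgue (ball x r) = measure lebesgue E)"
proof -
  define v where "v = unit_ball_vol (real CARD('n))"
  have v: "v > 0" by (simp add: v_def)
  have vol: "measure lebesgue (ball x r) = v * r ^ CARD('n)" if "r > 0" for x :: "real ^ 'n" and r
    using that by (simp add: content_ball v_def)
  define r where "r = root CARD('n) (measure lebesgue E / v)"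
  have pos: "measure lebesgue E / v > 0" using assms v by simp
  have r: "r > 0" "v * r ^ CARD('n) = measure lebesgue E"
  proof -
    show "r > 0" unfolding r_def using pos by (intro real_root_gt_zero) simp_all
    have "r ^ CARD('n) = measure lebesgue E / v"
      unfolding r_def using pos by (intro real_root_pow_pos) simp_all
    then show "v * r ^ CARD('n) = measure lebesgue E" using v by simp
  qed
  show ?thesis
  proof (rule ex1I[of _ r])
    show "0 < r \<and> (\<forall>x :: real ^ 'n. measure lebesgue (ball x r) = measure lebesgue E)"
      using r vol by simp
  next
    fix s assume s: "0 < s \<and> (\<forall>x :: real ^ 'n. measure lebesgue (ball x s) = measure lebesgue E)"
    have "v * s ^ CARD('n) = measure lebesgue (ball (0 :: real ^ 'n) s)"
      by (rule vol[symmetric], rule conjunct1[OF s])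
    also have "\<dots> = measure lebesgue E" by (rule spec[OF conjunct2[OF s]])
    also have "\<dots> = v * r ^ CARD('n)" by (rule r(2)[symmetric])
    finally have "v * s ^ CARD('n) = v * r ^ CARD('n)" .
    then have "s ^ CARD('n) = r ^ CARD('n)" using v by simp
    then show "s = r"
      by (rule power_eq_imp_eq_base) (use conjunct1[OF s] r(1) in simp_all)
  qed
qed

lemma ball_radius_props:
  fixes E :: "(real ^ 'n) set" and x :: "real ^ 'n"
  assumes "measure lebesgue E > 0"
  shows "ball_radius E > 0"
    and "measure lebesgue (ball x (ball_radius E)) = measure lebesgue E"
proof -
  have *: "0 < ball_radius E \<and>
      (\<forall>x :: real ^ 'n. measure lebesgue (ball x (ball_radius E)) = measure lebesgue E)"
    unfolding ball_radius_def by (rule theI'[OF ball_radius_ex1[OF assms]])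
  from * show "ball_radius E > 0" by (rule conjunct1)
  from * show "measure lebesgue (ball x (ball_radius E)) = measure lebesgue E"
    by (rule spec[OF conjunct2])
qed

lemma continuous_on_measure_Int_ball:
  fixes E :: "(real ^ 'n) set"
  assumes E: "E \<in> lmeasurable"
  shows "continuous_on UNIV (\<lambda>x. measure lebesgue (E \<inter> ball x r))"
proof (rule continuous_on_sequentiallyI)
  fix u and a :: "real ^ 'n"
  assume u: "u \<longlonglongrightarrow> a"
  have [measurable]: "E \<in> sets lebesgue" using E by (rule fmeasurableD)
  have [measurable]: "ball x r \<in> sets lebesgue" for x :: "real ^ 'n" by (rule fmeasurableD) simp
  have "(\<lambda>n. integral\<^sup>L lebesgue (indicat_real (E \<inter> ball (u n) r)))
          \<longlonglongrightarrow> integral\<^sup>L lebesgue (indicat_real (E \<inter> ball a r))"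
  proof (rule integral_dominated_convergence[where w = "indicat_real E"])
    have "negligible (sphere a r)" by (rule negligible_sphere)
    then have "AE y in lebesgue. y \<notin> sphere a r"
      by (intro AE_not_in) (simp add: negligible_iff_null_sets)
    then show "AE y in lebesgue. (\<lambda>n. indicat_real (E \<inter> ball (u n) r) y)
                 \<longlonglongrightarrow> indicat_real (E \<inter> ball a r) y"
    proof eventually_elim
      fix y assume y: "y \<notin> sphere a r"
      have d: "(\<lambda>n. dist (u n) y) \<longlonglongrightarrow> dist a y" by (intro tendsto_intros u)
      have "\<forall>\<^sub>F n in sequentially. (y \<in> ball (u n) r) = (y \<in> ball a r)"
      proof (cases "dist a y < r")
        case True
        from order_tendstoD(2)[OF d True] show ?thesis by eventually_elim (use True in simp)
      next
        case False
        with y have "dist a y > r" by auto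
        from order_tendstoD(1)[OF d this] show ?thesis by eventually_elim (use False in simp)
      qed
      then have "\<forall>\<^sub>F n in sequentially.
          indicat_real (E \<inter> ball (u n) r) y = indicat_real (E \<inter> ball a r) y"
        by eventually_elim (simp add: indicator_def)
      then show "(\<lambda>n. indicat_real (E \<inter> ball (u n) r) y) \<longlonglongrightarrow> indicat_real (E \<inter> ball a r) y"
        by (rule tendsto_eventually)
    qed
    show "integrable lebesgue (indicat_real E)"
      using E by (simp add: fmeasurable_def)
  qed (auto simp: indicator_def)
  then show "(\<lambda>n. measure lebesgue (E \<inter> ball (u n) r)) \<longlonglongrightarrow> measure lebesgue (E \<inter> ball a r)"
    by simp
qed

lemma measure_Int_ball_attains_max:
  fixes E :: "(real ^ 'n) set"
  assumes E: "E \<in> lmeasurable"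
  obtains x where "\<And>y. measure lebesgue (E \<inter> ball y r) \<le> measure lebesgue (E \<inter> ball x r)"
proof (cases "\<forall>x. measure lebesgue (E \<inter> ball x r) = 0")
  case True
  then show ?thesis by (intro that[of 0]) simp
next
  case False
  define g where "g x = measure lebesgue (E \<inter> ball x r)" for x
  from False obtain z where "g z \<noteq> 0" by (auto simp: g_def)
  moreover have "g z \<ge> 0" by (simp add: g_def)
  ultimately have z: "g z > 0" by linarith
  have *: "E - ball 0 (real k) \<in> lmeasurable" for k using E by (intro fmeasurable.Diff) auto
  have "(\<lambda>k. measure lebesgue (E - ball 0 (real k)))
          \<longlonglongrightarrow> measure lebesgue (\<Inter>k. E - ball 0 (real k))"
  proof (rule Lim_measure_decseq)
    show "range (\<lambda>k. E - ball 0 (real k)) \<subseteq> sets lebesgue" using * fmeasurableD by blast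
    show "decseq (\<lambda>k. E - ball 0 (real k))" by (auto simp: decseq_def)
    show "emeasure lebesgue (E - ball 0 (real k)) \<noteq> \<infinity>" for k
      using fmeasurableD2[OF *, of k] by (simp add: infinity_ennreal_def)
  qed
  moreover have "(\<Inter>k. E - ball 0 (real k)) = {}"
  proof -
    have "w \<notin> (\<Inter>k. E - ball 0 (real k))" for w
    proof -
      obtain k where "norm w < real k" using reals_Archimedean2 by blast
      then have "w \<in> ball 0 (real k)" by simp
      then show ?thesis by blast
    qed
    then show ?thesis by blast
  qed
  ultimately have "(\<lambda>k. measure lebesgue (E - ball 0 (real k))) \<longlonglongrightarrow> 0"
    by (simp only: measure_empty)
  from order_tendstoD(2)[OF this z] obtain k where k: "measure lebesgue (E - ball 0 (real k)) < g z"
    by (meson eventually_sequentially order_refl)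
  have far: "g y < g z" if "norm y \<ge> real k + r" for y
  proof -
    have "E \<inter> ball y r \<subseteq> E - ball 0 (real k)"
    proof
      fix w assume w: "w \<in> E \<inter> ball y r"
      have "norm y \<le> norm w + norm (y - w)" using norm_triangle_sub[of y w] by simp
      with w that have "real k < norm w" by (simp add: dist_norm)
      with w show "w \<in> E - ball 0 (real k)" by simp
    qed
    then have "g y \<le> measure lebesgue (E - ball 0 (real k))"
      unfolding g_def using E * by (intro measure_mono_fmeasurable) (auto simp: fmeasurableD)
    with k show ?thesis by simp
  qed
  define R where "R = max (norm z) (real k + r)"
  have "continuous_on (cball 0 R) g"
    using continuous_on_subset[OF continuous_on_measure_Int_ball[OF E]] unfolding g_def by auto
  moreover have zR: "z \<in> cball 0 R" by (simp add: R_def)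
  ultimately obtain x where x: "\<And>y. y \<in> cball 0 R \<Longrightarrow> g y \<le> g x"
    using continuous_attains_sup[of "cball 0 R" g] by (metis compact_cball empty_iff)
  have "g y \<le> g x" for y
  proof (cases "y \<in> cball 0 R")
    case False
    then have "norm y \<ge> real k + r" by (simp add: R_def)
    from far[OF this] x[OF zR] show ?thesis by linarith
  qed (rule x)
  then show ?thesis by (intro that[of x]) (simp add: g_def)
qed

lemma fraenkel_asymmetry_is_minimum:
  fixes E :: "(real ^ 'n) set"
  assumes E: "E \<in> lmeasurable" and pos: "measure lebesgue E > 0"
  obtains x where
    "fraenkel_asymmetry E = measure lebesgue (sym_diff E (ball x (ball_radius E))) / measure lebesgue E"
    "\<And>y. fraenkel_asymmetry E \<le> measure lebesgue (sym_diff E (ball y (ball_radius E))) / measure lebesgue E"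
proof -
  define r where "r = ball_radius E"
  define f where "f x = measure lebesgue (sym_diff E (ball x r)) / measure lebesgue E" for x
  have sd: "measure lebesgue (sym_diff E (ball x r))
      = 2 * measure lebesgue E - 2 * measure lebesgue (E \<inter> ball x r)" for x
  proof -
    have m: "E - ball x r \<in> lmeasurable" "ball x r - E \<in> lmeasurable" "E \<inter> ball x r \<in> lmeasurable"
      using E by (auto intro: fmeasurable.Diff fmeasurable.Int)
    have "measure lebesgue (sym_diff E (ball x r))
        = measure lebesgue (E - ball x r) + measure lebesgue (ball x r - E)"
      using m by (intro measure_Un_AE) auto
    moreover have "measure lebesgue ((E - ball x r) \<union> (E \<inter> ball x r))
        = measure lebesgue (E - ball x r) + measure lebesgue (E \<inter> ball x r)"
      using m by (intro measure_Un_AE) auto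
    moreover have "measure lebesgue ((ball x r - E) \<union> (E \<inter> ball x r))
        = measure lebesgue (ball x r - E) + measure lebesgue (E \<inter> ball x r)"
      using m by (intro measure_Un_AE) auto
    moreover have "(E - ball x r) \<union> (E \<inter> ball x r) = E" "(ball x r - E) \<union> (E \<inter> ball x r) = ball x r"
      by auto
    moreover have "measure lebesgue (ball x r) = measure lebesgue E"
      unfolding r_def by (rule ball_radius_props(2)[OF pos])
    ultimately show ?thesis by simp
  qed
  obtain x where x: "\<And>y. measure lebesgue (E \<inter> ball y r) \<le> measure lebesgue (E \<inter> ball x r)"
    using measure_Int_ball_attains_max[OF E] by blast
  have le: "f x \<le> f y" for y
    unfolding f_def sd using x[of y] pos by (intro divide_right_mono) auto
  have "(INF y. f y) = f x"
    by (intro cInf_eq_minimum) (auto intro: le)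
  then have "fraenkel_asymmetry E = f x" by (simp add: fraenkel_asymmetry_def f_def r_def)
  with le show ?thesis by (intro that[of x]) (auto simp: f_def r_def)
qed

end

theory Submission
  imports Defs
begin

text \<open>
  Let \<open>B\<close>, \<open>B1\<close>, \<open>B2\<close> be optimal balls for \<open>E\<close>, \<open>E1\<close>, \<open>E2\<close>, with radii \<open>r\<close>, \<open>r1 \<ge> r2\<close>, and let
  \<open>t\<close> be the quotient \<open>((r1 + r2)^n - r^n) / ((r1 + r2)^n - r1^n - r2^n)\<close> on the right-hand side;
  only \<open>t > 0\<close>, that is \<open>r < r1 + r2\<close>, matters. Two disjoint balls inside a third one satisfy
  \<open>r1 + r2 \<le> r\<close>, so here \<open>B1\<close> and \<open>B2\<close> cannot be disjoint and both lie in \<open>B\<close>. The triangle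
  inequality for the three centres makes this quantitative: either \<open>B1\<close> and \<open>B2\<close> overlap to a depth
  of at least \<open>2 / 3 * (r1 + r2 - r)\<close>, or one of them sticks out of \<open>B\<close> by at least that length.

  In each case the overlap or the protruding part contains a spherical cap of a ball of radius at
  least \<open>r2\<close>, with height proportional to \<open>r1 + r2 - r\<close>
  (\<open>measure_ball_Int_ball_ge\<close>, \<open>measure_ball_Diff_ball_ge\<close>), and the volume of a cap of height \<open>h\<close> and
  radius \<open>\<rho>\<close> is of order \<open>\<rho> powr ((n - 1) / 2) * h powr ((n + 1) / 2)\<close> (\<open>measure_spherical_cap_ge\<close>).
  On the other hand, \<open>E1\<close> and \<open>E2\<close> are disjoint and lie in \<open>E\<close>, so every point of \<open>B1 \<inter> B2\<close> and of
  \<open>Bi - B\<close> lies in the symmetric difference of one of the three sets and its ball. Hence this volume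
  is at most \<open>|E| D(E) + |E1| D(E1) + |E2| D(E2)\<close> (\<open>fraenkel_deficit_ge\<close>).

  An elementary estimate gives \<open>t * r2 \<le> n 2^(n-1) (r1 + r2 - r)\<close> (\<open>radius_deficit_ge\<close>), so the height can
  be taken proportional to \<open>t * r2\<close>, and the three deficits together are at least a constant times
  \<open>r2^n t powr ((n + 1) / 2)\<close>, which is \<open>|E2| t powr ((n + 1) / 2)\<close> up to a constant. One of the three
  terms is at least a third of this. Since \<open>n / (n - 1) \<ge> 1\<close>, the worst case for the weighted power
  is that this term belongs to the largest set \<open>E\<close> (\<open>mult_powr_ge\<close>), and the claim follows because
  \<open>|E| < (r1 + r2)^n |B(0,1)| \<le> 2^n |E1|\<close>.
\<close>

section \<open>Volume of spherical caps\<close>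

definition spherical_cap :: "'a::real_inner \<Rightarrow> real \<Rightarrow> real \<Rightarrow> 'a set" where
  "spherical_cap e \<rho> h = {u. norm u < \<rho> \<and> \<rho> - h < u \<bullet> e}"

text \<open>
  The volume of a box with side \<open>h / 2\<close> along the axis of the cap and sides
  \<open>2 * sqrt (\<rho> * h / (2 * n))\<close> across it. It has the order \<open>\<rho> powr ((n - 1) / 2) * h powr ((n + 1) / 2)\<close>
  of the true volume of a cap of height \<open>h \<le> \<rho>\<close>.
\<close>

definition cap_bound :: "nat \<Rightarrow> real \<Rightarrow> real \<Rightarrow> real" where
  "cap_bound n \<rho> h = (1/2) * sqrt (2 / real n) ^ (n - 1) * h * sqrt (\<rho> * h) ^ (n - 1)"

lemma cap_bound_mono:
  assumes "0 \<le> \<rho>" "\<rho> \<le> \<rho>'" "0 \<le> h"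
  shows "cap_bound n \<rho> h \<le> cap_bound n \<rho>' h"
  unfolding cap_bound_def
  using assms by (intro mult_left_mono power_mono real_sqrt_le_mono mult_right_mono) auto

lemma spherical_cap_lmeasurable [simp]:
  "spherical_cap (e :: 'a::euclidean_space) \<rho> h \<in> lmeasurable"
proof (rule lmeasurable_open)
  have "spherical_cap e \<rho> h = ball 0 \<rho> \<inter> {u. \<rho> - h < u \<bullet> e}"
    by (auto simp: spherical_cap_def)
  then show "bounded (spherical_cap e \<rho> h)" "open (spherical_cap e \<rho> h)"
    by (auto intro!: bounded_Int open_Int open_Collect_less continuous_intros)
qed

lemma orthogonal_image_spherical_cap:
  fixes f :: "'a::euclidean_space \<Rightarrow> 'a"
  assumes f: "orthogonal_transformation f" and e: "f e = e'"
  shows "f ` spherical_cap e \<rho> h = spherical_cap e' \<rho> h"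
proof -
  have "f u \<bullet> e' = u \<bullet> e" "norm (f u) = norm u" for u
    using f e by (auto simp: orthogonal_transformation_def orthogonal_transformation_norm)
  moreover have "surj f" using f by (rule orthogonal_transformation_surj)
  ultimately show ?thesis
    by (auto simp: spherical_cap_def surj_def image_iff) metis
qed

text \<open>
  Rotations preserve the volume of balls, and by Vitali's theorem an open set is a disjoint union of
  balls up to a null set, whose images are disjoint balls of the same volumes inside \<open>f ` U\<close>.
\<close>

lemma emeasure_open_le_orthogonal_image:
  fixes f :: "'a::euclidean_space \<Rightarrow> 'a"
  assumes f: "orthogonal_transformation f" and U: "open U"
  shows "emeasure lebesgue U \<le> emeasure lebesgue (f ` U)"
proof -
  define K where "K = {(a, s). 0 < s \<and> ball a s \<subseteq> U}"
  have fine: "\<exists>i. i \<in> K \<and> x \<in> ball (fst i) (snd i) \<and> snd i < d" if "x \<in> U" "0 < d" for x d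
  proof -
    obtain e where e: "e > 0" "ball x e \<subseteq> U" using U \<open>x \<in> U\<close> open_contains_ball by blast
    have "ball x (min e (d / 2)) \<subseteq> U" using e(2) by auto
    then show ?thesis
      using e(1) \<open>0 < d\<close> by (intro exI[of _ "(x, min e (d / 2))"]) (auto simp: K_def)
  qed
  obtain C where C: "countable C" "C \<subseteq> K"
    and pw: "pairwise (\<lambda>i j. disjnt (ball (fst i) (snd i)) (ball (fst j) (snd j))) C"
    and neg: "negligible (U - (\<Union>i\<in>C. ball (fst i) (snd i)))"
    using Vitali_covering_theorem_balls[of U K fst snd, OF fine] by blast
  let ?B = "\<lambda>i. ball (fst i) (snd i)"
  have Bs: "?B i \<in> sets lebesgue" for i :: "'a \<times> real" by (rule fmeasurableD) simp
  have fB: "f ` ?B i = ball (f (fst i)) (snd i)" for i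
    using f by (rule image_orthogonal_transformation_ball)
  have fBs: "f ` ?B i \<in> sets lebesgue" for i unfolding fB by (rule fmeasurableD) simp
  have inj: "inj f" using f by (rule orthogonal_transformation_inj)
  have disj: "disjoint_family_on ?B C" "disjoint_family_on (\<lambda>i. f ` ?B i) C"
    using pw inj unfolding disjoint_family_on_def pairwise_def disjnt_def
    by (auto simp: image_Int[symmetric])
  have balls: "emeasure lebesgue (?B i) = emeasure lebesgue (f ` ?B i)" if "i \<in> C" for i
    using that C(2) unfolding fB by (auto simp: K_def emeasure_ball)
  have Us: "(\<Union>i\<in>C. ?B i) \<in> sets lebesgue" using C(1) Bs by (intro sets.countable_UN') auto
  have N: "U - (\<Union>i\<in>C. ?B i) \<in> null_sets lebesgue" using neg by (simp add: negligible_iff_null_sets)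
  have "emeasure lebesgue U \<le> emeasure lebesgue ((\<Union>i\<in>C. ?B i) \<union> (U - (\<Union>i\<in>C. ?B i)))"
    using Us U by (intro emeasure_mono) (auto simp: borel_open)
  also have "\<dots> = emeasure lebesgue (\<Union>i\<in>C. ?B i)"
    using Us N by (rule emeasure_Un_null_set)
  also have "\<dots> = (\<integral>\<^sup>+i. emeasure lebesgue (?B i) \<partial>count_space C)"
    using C(1) disj Bs by (intro emeasure_UN_countable) auto
  also have "\<dots> = (\<integral>\<^sup>+i. emeasure lebesgue (f ` ?B i) \<partial>count_space C)"
    by (intro nn_integral_cong) (use balls in auto)
  also have "\<dots> = emeasure lebesgue (\<Union>i\<in>C. f ` ?B i)"
    using C(1) disj fBs by (intro emeasure_UN_countable[symmetric]) auto
  also have "\<dots> \<le> emeasure lebesgue (f ` U)"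
  proof (rule emeasure_mono)
    have "?B i \<subseteq> U" if "i \<in> C" for i using subsetD[OF C(2) that] by (simp add: K_def split_beta)
    then show "(\<Union>i\<in>C. f ` ?B i) \<subseteq> f ` U" by blast
    have "open (f ` U)"
      using f U by (intro open_surjective_linear_image)
        (auto simp: orthogonal_transformation_linear orthogonal_transformation_surj)
    then show "f ` U \<in> sets lebesgue" by (simp add: borel_open)
  qed
  finally show ?thesis .
qed

text \<open>
  A point whose axial coordinate lies between \<open>\<rho> - h\<close> and \<open>\<rho> - h / 2\<close> has room
  \<open>\<rho>\<^sup>2 - (\<rho> - h / 2)\<^sup>2 \<ge> \<rho> * h / 2\<close> left for the squared norm of its transversal part, so the cap
  contains a box of volume \<open>cap_bound\<close>. A rotation reduces the general axis to a coordinate axis.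
\<close>

lemma measure_spherical_cap_ge:
  fixes e :: "real ^ 'n"
  assumes e: "norm e = 1" and h: "0 < h" "h \<le> \<rho>"
  shows "cap_bound CARD('n) \<rho> h \<le> measure lebesgue (spherical_cap e \<rho> h)"
proof -
  obtain k :: 'n where True by simp
  define w where "w = sqrt (\<rho> * h / (2 * real CARD('n)))"
  have w: "w > 0" "w\<^sup>2 = \<rho> * h / (2 * real CARD('n))" using h by (auto simp: w_def)
  define a :: "real ^ 'n" where "a = (\<chi> i. if i = k then \<rho> - h else - w)"
  define b :: "real ^ 'n" where "b = (\<chi> i. if i = k then \<rho> - h / 2 else w)"
  have sub: "box a b \<subseteq> spherical_cap (axis k 1) \<rho> h"
  proof
    fix u assume "u \<in> box a b"
    then have ui: "a $ i < u $ i" "u $ i < b $ i" for i by (auto simp: mem_box_cart)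
    have uk: "\<rho> - h < u $ k" "u $ k < \<rho> - h / 2"
      using ui[of k] by (auto simp: a_def b_def)
    have uw: "(u $ i)\<^sup>2 \<le> w\<^sup>2" if "i \<noteq> k" for i
      using ui[of i] that by (intro abs_le_square_iff[THEN iffD1]) (auto simp: a_def b_def)
    have "(norm u)\<^sup>2 = (\<Sum>i\<in>UNIV. (u $ i)\<^sup>2)"
      by (simp add: norm_vec_def L2_set_def sum_nonneg)
    also have "\<dots> = (u $ k)\<^sup>2 + (\<Sum>i\<in>UNIV - {k}. (u $ i)\<^sup>2)"
      by (subst sum.remove[of _ k]) auto
    also have "(\<Sum>i\<in>UNIV - {k}. (u $ i)\<^sup>2) \<le> (\<Sum>i\<in>UNIV - {k}. w\<^sup>2)"
      by (intro sum_mono uw) auto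
    also have "\<dots> \<le> (\<Sum>i\<in>(UNIV :: 'n set). w\<^sup>2)"
      by (intro sum_mono2) auto
    also have "\<dots> = \<rho> * h / 2" by (simp add: w)
    also have "(u $ k)\<^sup>2 < (\<rho> - h / 2)\<^sup>2"
      using uk h by (intro power_strict_mono) auto
    also have "(\<rho> - h / 2)\<^sup>2 + \<rho> * h / 2 \<le> \<rho>\<^sup>2"
      using h mult_right_mono[of h \<rho> h] by (simp add: power2_eq_square field_simps)
    finally have "(norm u)\<^sup>2 < \<rho>\<^sup>2" by simp
    then have "norm u < \<rho>" by (rule power2_less_imp_less) (use h in simp)
    with uk show "u \<in> spherical_cap (axis k 1) \<rho> h"
      by (simp add: spherical_cap_def inner_axis)
  qed
  have "measure lebesgue (box a b) = (\<Prod>i\<in>UNIV. b $ i - a $ i)"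
  proof -
    have "cbox a b \<noteq> {}"
      using h w by (auto simp: interval_ne_empty_cart a_def b_def)
    then have "measure lborel (cbox a b) = (\<Prod>i\<in>UNIV. b $ i - a $ i)" by (rule content_cbox_cart)
    then show ?thesis by (simp add: measure_lborel_box_eq measure_lborel_cbox_eq)
  qed
  also have "\<dots> = h / 2 * (\<Prod>i\<in>UNIV - {k}. 2 * w)"
    by (subst prod.remove[of _ k]) (auto simp: a_def b_def intro!: prod.cong)
  also have "\<dots> = h / 2 * (2 * w) ^ (CARD('n) - 1)" by simp
  also have "2 * w = sqrt (2 / real CARD('n)) * sqrt (\<rho> * h)"
  proof -
    have "2 * w = sqrt (4 * (\<rho> * h / (2 * real CARD('n))))"
      unfolding w_def by (simp only: real_sqrt_mult real_sqrt_four)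
    also have "4 * (\<rho> * h / (2 * real CARD('n))) = 2 / real CARD('n) * (\<rho> * h)" by simp
    finally show ?thesis by (simp only: real_sqrt_mult)
  qed
  finally have vol: "measure lebesgue (box a b) = cap_bound CARD('n) \<rho> h"
    by (simp add: cap_bound_def power_mult_distrib)
  obtain f where f: "orthogonal_transformation f" "f (axis k 1 :: real ^ 'n) = e"
    using orthogonal_transformation_exists_1[of "axis k 1 :: real ^ 'n" e] e
    by (auto simp: norm_axis_1)
  have "emeasure lebesgue (box a b) \<le> emeasure lebesgue (f ` box a b)"
    by (rule emeasure_open_le_orthogonal_image[OF f(1) open_box])
  also have "\<dots> \<le> emeasure lebesgue (spherical_cap e \<rho> h)"
    using image_mono[OF sub, of f] unfolding orthogonal_image_spherical_cap[OF f]
    by (intro emeasure_mono) (auto intro: fmeasurableD)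
  finally have "measure lebesgue (box a b) \<le> measure lebesgue (spherical_cap e \<rho> h)"
    by (simp add: emeasure_eq_measure2 measure_nonneg)
  then show ?thesis by (simp only: vol)
qed

lemma measure_ge_of_translated_cap:
  fixes e y :: "real ^ 'n"
  assumes "norm e = 1" "0 < h" "h \<le> \<rho>"
    and "(+) y ` spherical_cap e \<rho> h \<subseteq> A" "A \<in> lmeasurable"
  shows "cap_bound CARD('n) \<rho> h \<le> measure lebesgue A"
proof -
  have "measure lebesgue (spherical_cap e \<rho> h) = measure lebesgue ((+) y ` spherical_cap e \<rho> h)"
    by (simp add: measure_translation)
  also have "\<dots> \<le> measure lebesgue A"
    using assms by (intro measure_mono_fmeasurable) (auto intro!: fmeasurableD measurable_translation)
  finally show ?thesis using measure_spherical_cap_ge[OF assms(1-3)] by linarith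
qed

section \<open>Overlapping and protruding balls\<close>

lemma unit_direction:
  fixes x y :: "real ^ 'n"
  obtains e where "norm e = 1" "y = x + dist x y *\<^sub>R e"
proof (cases "x = y")
  case True
  then show ?thesis by (intro that[of "axis undefined 1"]) (auto simp: norm_axis_1)
next
  case False
  then show ?thesis
    by (intro that[of "(1 / dist x y) *\<^sub>R (y - x)"]) (auto simp: dist_norm norm_minus_commute)
qed

text \<open>
  The cap of the smaller ball that faces \<open>x\<close> is contained in the larger ball. For equal radii and
  depth \<open>2 * h\<close> it is half of the symmetric lens. Larger values of \<open>r1\<close> follow because the larger
  ball contains the ball of radius \<open>r2\<close> whose centre is moved towards \<open>y\<close> by at most \<open>r1 - r2\<close>.
\<close>

lemma measure_ball_Int_ball_ge:
  fixes x y :: "real ^ 'n"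
  assumes h: "0 < h" "h \<le> r2" and r: "r2 \<le> r1" and d: "dist x y \<le> r1 + r2 - 2 * h"
  shows "cap_bound CARD('n) r2 h \<le> measure lebesgue (ball x r1 \<inter> ball y r2)"
proof -
  define d where "d = dist x y"
  obtain e where e: "norm e = 1" "y = x + d *\<^sub>R e"
    using unit_direction[of y x] unfolding d_def by blast
  have ee: "e \<bullet> e = 1" using e(1) by (simp add: norm_eq_1)
  show ?thesis
  proof (rule measure_ge_of_translated_cap[where e = "- e" and y = y])
    show "(+) y ` spherical_cap (- e) r2 h \<subseteq> ball x r1 \<inter> ball y r2"
    proof safe
      fix u assume "u \<in> spherical_cap (- e) r2 h"
      then have u: "norm u < r2" "u \<bullet> e < - (r2 - h)" by (auto simp: spherical_cap_def)
      show "y + u \<in> ball y r2" using u by (simp add: dist_norm)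
      \<comment> \<open>The cap is contained in every ball of radius \<open>r2\<close> whose centre is moved from \<open>y\<close> towards \<open>x\<close>
        by at most \<open>2 * (r2 - h)\<close>; the remaining distance is absorbed by \<open>r1 - r2\<close>.\<close>
      have shift: "norm (u + c *\<^sub>R e) < r2" if c: "0 \<le> c" "c \<le> 2 * (r2 - h)" for c
      proof -
        have "(norm (u + c *\<^sub>R e))\<^sup>2 = (norm u)\<^sup>2 + c * (2 * (u \<bullet> e) + c)"
          by (simp add: power2_norm_eq_inner inner_add_left inner_add_right ee inner_commute
              algebra_simps)
        also have "c * (2 * (u \<bullet> e) + c) \<le> 0"
          using u c by (intro mult_nonneg_nonpos) auto
        finally have "(norm (u + c *\<^sub>R e))\<^sup>2 \<le> (norm u)\<^sup>2" by simp
        then have "norm (u + c *\<^sub>R e) \<le> norm u" by (rule power2_le_imp_le) simp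
        with u show ?thesis by simp
      qed
      have "norm (u + d *\<^sub>R e) < r1"
      proof (cases "d \<le> 2 * (r2 - h)")
        case True
        then show ?thesis using shift[of d] r by (simp add: d_def)
      next
        case False
        have "u + d *\<^sub>R e = (u + (2 * (r2 - h)) *\<^sub>R e) + (d - 2 * (r2 - h)) *\<^sub>R e"
          by (simp add: algebra_simps)
        then have "norm (u + d *\<^sub>R e)
            \<le> norm (u + (2 * (r2 - h)) *\<^sub>R e) + norm ((d - 2 * (r2 - h)) *\<^sub>R e)"
          using norm_triangle_ineq by metis
        also have "\<dots> < r2 + (d - 2 * (r2 - h))"
          using shift[of "2 * (r2 - h)"] h False e by simp
        also have "\<dots> \<le> r1" using assms(4) by (simp add: d_def)
        finally show ?thesis .
      qed
      moreover have "dist x (y + u) = norm (u + d *\<^sub>R e)"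
        unfolding dist_commute[of x] by (simp add: e(2) dist_norm algebra_simps)
      ultimately show "y + u \<in> ball x r1" by simp
    qed
  qed (use h e in auto)
qed

text \<open>
  The hyperplane orthogonal to the line of centres that touches \<open>ball x r\<close> on the side of \<open>y\<close> cuts
  off from \<open>ball y \<rho>\<close> a cap of height at least \<open>h\<close>, and this cap is disjoint from \<open>ball x r\<close>.
\<close>

lemma measure_ball_Diff_ball_ge:
  fixes x y :: "real ^ 'n"
  assumes h: "0 < h" "h \<le> \<rho>" and d: "dist x y \<ge> r - \<rho> + h"
  shows "cap_bound CARD('n) \<rho> h \<le> measure lebesgue (ball y \<rho> - ball x r)"
proof -
  define d where "d = dist x y"
  obtain e where e: "norm e = 1" "y = x + d *\<^sub>R e"
    using unit_direction[of y x] unfolding d_def by blast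
  have ee: "e \<bullet> e = 1" using e(1) by (simp add: norm_eq_1)
  show ?thesis
  proof (rule measure_ge_of_translated_cap[where e = e and y = y])
    show "(+) y ` spherical_cap e \<rho> h \<subseteq> ball y \<rho> - ball x r"
    proof safe
      fix u assume "u \<in> spherical_cap e \<rho> h"
      then have u: "norm u < \<rho>" "u \<bullet> e > \<rho> - h" by (auto simp: spherical_cap_def)
      show "y + u \<in> ball y \<rho>" using u by (simp add: dist_norm)
      assume "y + u \<in> ball x r"
      moreover have "dist x (y + u) = norm (u + d *\<^sub>R e)"
        unfolding dist_commute[of x] by (simp add: e(2) dist_norm algebra_simps)
      ultimately have "norm (u + d *\<^sub>R e) < r" by simp
      moreover have "(u + d *\<^sub>R e) \<bullet> e \<le> norm (u + d *\<^sub>R e)"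
        using norm_cauchy_schwarz[of "u + d *\<^sub>R e" e] e by simp
      moreover have "(u + d *\<^sub>R e) \<bullet> e = u \<bullet> e + d" by (simp add: inner_add_left ee)
      ultimately show False using u assms(3) by (simp add: d_def)
    qed
    show "ball y \<rho> - ball x r \<in> lmeasurable" by (intro fmeasurable.Diff) auto
  qed (use h e in auto)
qed

section \<open>The asymmetries control the defect of the radii\<close>

text \<open>
  If none of the three alternatives in the proof held, the centres of the optimal balls would satisfy
  \<open>r1 + r2 - 2 * h < dist x1 x2 \<le> dist x x1 + dist x x2 < 2 * r - r1 - r2 + 4 * h\<close>, which
  contradicts \<open>3 * h \<le> r1 + r2 - r\<close>.
\<close>

lemma fraenkel_deficit_ge:
  fixes E E1 E2 :: "(real ^ 'n) set"
  defines "r \<equiv> ball_radius E" and "r1 \<equiv> ball_radius E1" and "r2 \<equiv> ball_radius E2"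
  assumes lm: "E \<in> lmeasurable" "E1 \<in> lmeasurable" "E2 \<in> lmeasurable"
    and pos: "measure lebesgue E > 0" "measure lebesgue E1 > 0" "measure lebesgue E2 > 0"
    and sub: "E1 \<union> E2 \<subseteq> E" and disj: "E1 \<inter> E2 = {}"
    and r: "r2 \<le> r1"
    and h: "0 < h" "2 * h \<le> r2" "3 * h \<le> r1 + r2 - r"
  shows "cap_bound CARD('n) r2 h
    \<le> measure lebesgue E * fraenkel_asymmetry E + measure lebesgue E1 * fraenkel_asymmetry E1
        + measure lebesgue E2 * fraenkel_asymmetry E2"
proof -
  have ex: "\<exists>x. measure lebesgue F * fraenkel_asymmetry F
              = measure lebesgue (sym_diff F (ball x (ball_radius F)))"
    if "F \<in> lmeasurable" "measure lebesgue F > 0" for F :: "(real ^ 'n) set"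
    using fraenkel_asymmetry_is_minimum[OF that] that by (metis nonzero_mult_div_cancel_left
        times_divide_eq_right less_irrefl)
  obtain x where x: "measure lebesgue E * fraenkel_asymmetry E
      = measure lebesgue (sym_diff E (ball x r))" using ex[OF lm(1) pos(1)] by (auto simp: r_def)
  obtain x1 where x1: "measure lebesgue E1 * fraenkel_asymmetry E1
      = measure lebesgue (sym_diff E1 (ball x1 r1))" using ex[OF lm(2) pos(2)] by (auto simp: r1_def)
  obtain x2 where x2: "measure lebesgue E2 * fraenkel_asymmetry E2
      = measure lebesgue (sym_diff E2 (ball x2 r2))" using ex[OF lm(3) pos(3)] by (auto simp: r2_def)
  have sdm: "sym_diff F (ball z s) \<in> lmeasurable" if "F \<in> lmeasurable" for F and z :: "real^'n" and s
    using that by (intro fmeasurable.Diff fmeasurable.Un) auto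
  have cover: "measure lebesgue A \<le> measure lebesgue B + measure lebesgue C"
    if "A \<subseteq> B \<union> C" "A \<in> lmeasurable" "B \<in> lmeasurable" "C \<in> lmeasurable" for A B C :: "(real ^ 'n) set"
    using that measure_mono_fmeasurable[of A "B \<union> C" lebesgue] measure_Un_le[of B lebesgue C]
    by (auto simp: fmeasurable.Un fmeasurableD)
  have "dist x1 x2 \<le> dist x x1 + dist x x2" by (metis dist_commute dist_triangle)
  then consider "dist x1 x2 \<le> r1 + r2 - 2 * h" | "dist x x1 \<ge> r - r1 + 2 * h"
    | "dist x x2 \<ge> r - r2 + 2 * h" using h by linarith
  then show ?thesis
  proof cases
    case 1
    have "cap_bound CARD('n) r2 h \<le> measure lebesgue (ball x1 r1 \<inter> ball x2 r2)"
      by (rule measure_ball_Int_ball_ge) (use 1 h r in auto)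
    also have "\<dots> \<le> measure lebesgue (sym_diff E1 (ball x1 r1))
                    + measure lebesgue (sym_diff E2 (ball x2 r2))"
      by (rule cover) (use disj sdm lm in auto)
    finally show ?thesis using measure_nonneg[of lebesgue "sym_diff E (ball x r)"]
      unfolding x x1 x2 by linarith
  next
    case 2
    have "cap_bound CARD('n) r2 h \<le> cap_bound CARD('n) r1 h"
      using r h by (auto intro: cap_bound_mono)
    also have "\<dots> \<le> measure lebesgue (ball x1 r1 - ball x r)"
      by (rule measure_ball_Diff_ball_ge) (use 2 h r in auto)
    also have "\<dots> \<le> measure lebesgue (sym_diff E1 (ball x1 r1))
                    + measure lebesgue (sym_diff E (ball x r))"
      by (rule cover) (use sub sdm lm in \<open>auto intro: fmeasurable.Diff\<close>)
    finally show ?thesis using measure_nonneg[of lebesgue "sym_diff E2 (ball x2 r2)"]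
      unfolding x x1 x2 by linarith
  next
    case 3
    have "cap_bound CARD('n) r2 h \<le> measure lebesgue (ball x2 r2 - ball x r)"
      by (rule measure_ball_Diff_ball_ge) (use 3 h r in auto)
    also have "\<dots> \<le> measure lebesgue (sym_diff E2 (ball x2 r2))
                    + measure lebesgue (sym_diff E (ball x r))"
      by (rule cover) (use sub sdm lm in \<open>auto intro: fmeasurable.Diff\<close>)
    finally show ?thesis using measure_nonneg[of lebesgue "sym_diff E1 (ball x1 r1)"]
      unfolding x x1 x2 by linarith
  qed
qed

section \<open>Elementary inequalities\<close>

lemma power_superadditive:
  fixes a b :: real
  assumes "0 \<le> a" "0 \<le> b" "0 < k"
  shows "a ^ k + b ^ k \<le> (a + b) ^ k"
  using assms(3)
proof (induction k rule: nat_induct_non_zero)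
  case (Suc k)
  have "a ^ Suc k + b ^ Suc k \<le> (a + b) * (a ^ k + b ^ k)"
    using assms by (simp add: algebra_simps)
  also have "\<dots> \<le> (a + b) * (a + b) ^ k"
    using Suc assms by (intro mult_left_mono) auto
  finally show ?case by simp
qed simp

text \<open>
  The numerator vanishes at \<open>r = r1 + r2\<close> and decreases in \<open>r\<close> at a rate of at most \<open>n * (2 * r1) ^ (n - 1)\<close>,
  while the denominator is at least \<open>r1 ^ (n - 1) * r2\<close>.
\<close>

lemma radius_deficit_ge:
  fixes r r1 r2 :: real
  assumes n: "n \<ge> 2" and r2: "0 < r2" "r2 \<le> r1" and r: "0 \<le> r" "r \<le> r1 + r2"
  shows "((r1 + r2) ^ n - r ^ n) / ((r1 + r2) ^ n - r1 ^ n - r2 ^ n) * r2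
           \<le> real n * 2 ^ (n - 1) * (r1 + r2 - r)"
    and "(r1 + r2) ^ n - r1 ^ n - r2 ^ n > 0"
proof -
  obtain k where k: "n = Suc k" "k > 0" using n by (cases n) auto
  have "r1 ^ k * r2 \<le> (r1 + r2) * (r1 ^ k + r2 ^ k) - r1 ^ n - r2 ^ n"
    using r2 by (simp add: k algebra_simps)
  also have "\<dots> \<le> (r1 + r2) ^ n - r1 ^ n - r2 ^ n"
    using power_superadditive[of r1 r2 k] r2 k by (simp add: mult_left_mono)
  finally have den: "r1 ^ k * r2 \<le> (r1 + r2) ^ n - r1 ^ n - r2 ^ n" .
  have p: "r1 ^ k * r2 > 0" using r2 by simp
  then show "(r1 + r2) ^ n - r1 ^ n - r2 ^ n > 0" using den by linarith
  have "(r1 + r2) ^ n - r ^ n = (r1 + r2 - r) * (\<Sum>i<n. r ^ (n - Suc i) * (r1 + r2) ^ i)"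
    by (rule power_diff_sumr2)
  also have "(\<Sum>i<n. r ^ (n - Suc i) * (r1 + r2) ^ i) \<le> (\<Sum>i<n. (r1 + r2) ^ k)"
  proof (rule sum_mono)
    fix i assume i: "i \<in> {..<n}"
    have "r ^ (n - Suc i) * (r1 + r2) ^ i \<le> (r1 + r2) ^ (n - Suc i) * (r1 + r2) ^ i"
      using r r2 by (intro mult_right_mono power_mono) auto
    also have "\<dots> = (r1 + r2) ^ k" using i by (simp add: k flip: power_add)
    finally show "r ^ (n - Suc i) * (r1 + r2) ^ i \<le> (r1 + r2) ^ k" .
  qed
  also have "(\<Sum>i<n. (r1 + r2) ^ k) = real n * (r1 + r2) ^ k" by simp
  also have "(r1 + r2) ^ k \<le> (2 * r1) ^ k" using r2 by (intro power_mono) auto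
  finally have num: "(r1 + r2) ^ n - r ^ n \<le> (r1 + r2 - r) * (real n * (2 * r1) ^ k)"
    using r by (simp add: mult_left_mono)
  have "((r1 + r2) ^ n - r ^ n) / ((r1 + r2) ^ n - r1 ^ n - r2 ^ n)
      \<le> (r1 + r2 - r) * (real n * (2 * r1) ^ k) / (r1 ^ k * r2)"
    using num den p r r2 by (intro frac_le) auto
  then have "((r1 + r2) ^ n - r ^ n) / ((r1 + r2) ^ n - r1 ^ n - r2 ^ n) * r2
      \<le> (r1 + r2 - r) * (real n * (2 * r1) ^ k) / (r1 ^ k * r2) * r2"
    using r2 by (intro mult_right_mono) auto
  also have "\<dots> = real n * 2 ^ (n - 1) * (r1 + r2 - r)"
    using r2 by (simp add: k power_mult_distrib)
  finally show "((r1 + r2) ^ n - r ^ n) / ((r1 + r2) ^ n - r1 ^ n - r2 ^ n) * r2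
           \<le> real n * 2 ^ (n - 1) * (r1 + r2 - r)" .
qed

text \<open>
  For \<open>p \<ge> 1\<close> and \<open>q \<ge> 0\<close>, \<open>s * (q / s) powr p = q * (q / s) powr (p - 1)\<close> does not increase with \<open>s > 0\<close>: a given
  deficit \<open>q\<close> costs least on the largest set.
\<close>

lemma mult_powr_ge:
  fixes m :: real
  assumes "p \<ge> 1" "0 < m'" "m' \<le> m" "0 \<le> q" "q \<le> m' * d"
  shows "m * (q / m) powr p \<le> m' * d powr p"
proof (cases "q = 0")
  case False
  with assms have q: "q > 0" by simp
  have expand: "s * (q / s) powr p = q * (q / s) powr (p - 1)" if "s > 0" for s
    using that q by (simp add: powr_diff)
  have "m * (q / m) powr p = q * (q / m) powr (p - 1)" using assms by (intro expand) auto
  also have "\<dots> \<le> q * (q / m') powr (p - 1)"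
    using assms q by (intro mult_left_mono powr_mono2 divide_left_mono) auto
  also have "\<dots> = m' * (q / m') powr p" using assms by (intro expand[symmetric]) auto
  also have "\<dots> \<le> m' * d powr p"
    using assms by (intro mult_left_mono powr_mono2) (auto simp: field_simps)
  finally show ?thesis .
qed (use assms in simp)

lemma measure_eq_ball_radius:
  fixes E :: "(real ^ 'n) set"
  assumes "measure lebesgue E > 0"
  shows "measure lebesgue E = unit_ball_vol (real CARD('n)) * ball_radius E ^ CARD('n)"
  using ball_radius_props(1)[OF assms] ball_radius_props(2)[OF assms, where x = 0] by (simp add: content_ball)

section \<open>The stability inequality\<close>

theorem proposition1p2:
  assumes "CARD('n::finite) \<ge> 2"
  shows "\<exists>C::real. C > 0 \<and>
    (\<forall>E E\<^sub>1 E\<^sub>2 :: (real ^ 'n) set.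
      E \<in> lmeasurable \<and> E\<^sub>1 \<in> lmeasurable \<and> E\<^sub>2 \<in> lmeasurable \<and>
      measure lebesgue E > 0 \<and> measure lebesgue E\<^sub>1 > 0 \<and> measure lebesgue E\<^sub>2 > 0 \<and>
      E\<^sub>1 \<union> E\<^sub>2 \<subseteq> E \<and> E\<^sub>1 \<inter> E\<^sub>2 = {} \<and>
      measure lebesgue E\<^sub>1 \<ge> measure lebesgue E\<^sub>2
      \<longrightarrow>
      (let n = real CARD('n);
           S = (measure lebesgue E\<^sub>1 powr (1 / n) + measure lebesgue E\<^sub>2 powr (1 / n)) ^ CARD('n)
       in
        (measure lebesgue E * fraenkel_asymmetry E powr (n / (n - 1))
         + measure lebesgue E\<^sub>1 * fraenkel_asymmetry E\<^sub>1 powr (n / (n - 1))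
         + measure lebesgue E\<^sub>2 * fraenkel_asymmetry E\<^sub>2 powr (n / (n - 1)))
        / (measure lebesgue E + measure lebesgue (E\<^sub>1 \<union> E\<^sub>2))
        \<ge> C * (measure lebesgue E\<^sub>2 / (measure lebesgue E\<^sub>1 + measure lebesgue E\<^sub>2)) powr (n / (n - 1))
          * (max 0 ((S - measure lebesgue E) / (S - measure lebesgue (E\<^sub>1 \<union> E\<^sub>2))))
              powr (n * (n + 1) / (2 * (n - 1)))))"
proof -
  define n where "n = CARD('n)"
  define p where "p = real n / (real n - 1)"
  define \<omega> where "\<omega> = unit_ball_vol (real n)"
  define K where "K = (1/2) * sqrt (2 / real n) ^ (n - 1)"
  \<comment> \<open>Chosen so that the height \<open>\<kappa> * t * r2\<close> is at most a third of \<open>r1 + r2 - r\<close>, by \<open>radius_deficit_ge\<close>.\<close>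
  define \<kappa> where "\<kappa> = 1 / (3 * (real n * 2 ^ (n - 1)))"
  define A where "A = K * \<kappa> * sqrt \<kappa> ^ (n - 1) / \<omega>"
  \<comment> \<open>The factor 3 selects one of the three deficits, \<open>2 ^ n\<close> bounds \<open>|E|\<close> by \<open>|E1| + |E2|\<close>, and the
    factor 1/2 bounds the denominator \<open>|E| + |E1 \<union> E2|\<close> by \<open>2 * |E|\<close>.\<close>
  define C where "C = (1/2) * (A / (3 * 2 ^ n)) powr p"
  have n: "n \<ge> 2" using assms by (simp add: n_def)
  have p: "p \<ge> 1" using n by (simp add: p_def field_simps)
  have \<omega>: "\<omega> > 0" by (simp add: \<omega>_def)
  have K: "K > 0" using n by (simp add: K_def)
  have \<kappa>: "\<kappa> > 0" using n by (simp add: \<kappa>_def)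
  have "1 * (2::real) \<le> real n * 2 ^ (n - 1)"
    using n power_increasing[of 1 "n - 1" "2::real"] by (intro mult_mono) auto
  then have \<kappa>6: "\<kappa> \<le> 1 / 6" unfolding \<kappa>_def by (intro divide_left_mono) auto
  have A: "A > 0" using K \<kappa> \<omega> by (simp add: A_def)
  have C: "C > 0" using A by (simp add: C_def)
  show ?thesis
  proof (intro exI[of _ C] conjI C allI impI, elim conjE)
    fix E E1 E2 :: "(real ^ 'n) set"
    assume lm: "E \<in> lmeasurable" "E1 \<in> lmeasurable" "E2 \<in> lmeasurable"
      and pos: "measure lebesgue E > 0" "measure lebesgue E1 > 0" "measure lebesgue E2 > 0"
      and sub: "E1 \<union> E2 \<subseteq> E" and disj: "E1 \<inter> E2 = {}"
      and le: "measure lebesgue E2 \<le> measure lebesgue E1"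
    define m where "m = measure lebesgue E"
    define m1 where "m1 = measure lebesgue E1"
    define m2 where "m2 = measure lebesgue E2"
    define r where "r = ball_radius E"
    define r1 where "r1 = ball_radius E1"
    define r2 where "r2 = ball_radius E2"
    define D where "D = fraenkel_asymmetry E"
    define D1 where "D1 = fraenkel_asymmetry E1"
    define D2 where "D2 = fraenkel_asymmetry E2"
    define S where "S = (m1 powr (1 / real n) + m2 powr (1 / real n)) ^ n"
    define t where "t = max 0 ((S - m) / (S - (m1 + m2)))"
    have rpos: "r > 0" "r1 > 0" "r2 > 0"
      unfolding r_def r1_def r2_def using pos by (intro ball_radius_props(1); simp)+
    have vol: "m = \<omega> * r ^ n" "m1 = \<omega> * r1 ^ n" "m2 = \<omega> * r2 ^ n"
      unfolding m_def m1_def m2_def r_def r1_def r2_def \<omega>_def n_def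
      using pos by (intro measure_eq_ball_radius; simp)+
    have mpos: "m > 0" "m1 > 0" "m2 > 0" using pos by (simp_all add: m_def m1_def m2_def)
    have m12: "measure lebesgue (E1 \<union> E2) = m1 + m2"
      using lm disj unfolding m1_def m2_def by (intro measure_Un_AE) auto
    have m12_le: "m1 + m2 \<le> m"
      using sub lm unfolding m12[symmetric] m_def
      by (intro measure_mono_fmeasurable) (auto intro: fmeasurableD)
    have r_le: "r2 \<le> r1"
      using le vol \<omega> rpos n unfolding m1_def[symmetric] m2_def[symmetric]
      by (simp add: power_mono_iff)
    have root: "(\<omega> * s ^ n) powr (1 / real n) = \<omega> powr (1 / real n) * s" if "s > 0" for s
      using that \<omega> n by (simp add: powr_mult powr_powr flip: powr_realpow)
    have "S = (\<omega> powr (1 / real n) * (r1 + r2)) ^ n"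
      using rpos by (simp add: S_def vol root distrib_left)
    also have "\<dots> = \<omega> * (r1 + r2) ^ n"
      using \<omega> n by (simp add: power_mult_distrib powr_powr flip: powr_realpow)
    finally have S: "S = \<omega> * (r1 + r2) ^ n" .
    have main: "C * (m2 / (m1 + m2)) powr p * t powr (real n * (real n + 1) / (2 * (real n - 1)))
        \<le> (m * D powr p + m1 * D1 powr p + m2 * D2 powr p) / (m + (m1 + m2))"
    proof (cases "t = 0")
      case True
      with mpos show ?thesis by simp
    next
      case False
      moreover have "t \<ge> 0" by (simp add: t_def)
      ultimately have "t > 0" by simp
      moreover from this have "t = (S - m) / (S - (m1 + m2))"
        by (auto simp: t_def max_def split: if_splits)
      ultimately have t: "t > 0" "t = (S - m) / (S - (m1 + m2))" .
      have "S - (m1 + m2) = \<omega> * ((r1 + r2) ^ n - r1 ^ n - r2 ^ n)"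
        by (simp add: S vol algebra_simps)
      moreover have gap: "(r1 + r2) ^ n - r1 ^ n - r2 ^ n > 0"
        using radius_deficit_ge(2)[of n r2 r1 0] n rpos r_le by simp
      ultimately have Spos: "S - (m1 + m2) > 0" using \<omega> by simp
      with t have "S - m > 0" by (simp add: zero_less_divide_iff)
      then have mS: "m < S" by simp
      have t1: "t \<le> 1" using Spos m12_le by (simp add: t)
      have "r ^ n < (r1 + r2) ^ n" using mS \<omega> by (simp add: S vol)
      then have r_less: "r < r1 + r2" by (rule power_less_imp_less_base) (use rpos in simp)
      have t_eq: "t = ((r1 + r2) ^ n - r ^ n) / ((r1 + r2) ^ n - r1 ^ n - r2 ^ n)"
      proof -
        have "t = (\<omega> * ((r1 + r2) ^ n - r ^ n)) / (\<omega> * ((r1 + r2) ^ n - r1 ^ n - r2 ^ n))"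
          unfolding t S vol by (simp add: algebra_simps)
        with \<omega> show ?thesis by simp
      qed
      define h where "h = \<kappa> * t * r2"
      have h: "0 < h" "2 * h \<le> r2" "3 * h \<le> r1 + r2 - r"
      proof -
        show "0 < h" using \<kappa> t(1) rpos by (simp add: h_def)
        have "\<kappa> * t \<le> 1 / 6 * 1" using \<kappa> \<kappa>6 t t1 by (intro mult_mono) auto
        then have "h \<le> 1 / 6 * 1 * r2" unfolding h_def using rpos by (intro mult_right_mono) auto
        then show "2 * h \<le> r2" using rpos by simp
        have "t * r2 \<le> real n * 2 ^ (n - 1) * (r1 + r2 - r)"
          unfolding t_eq using radius_deficit_ge(1)[of n r2 r1 r] n rpos r_le r_less by simp
        then have "\<kappa> * (t * r2) \<le> \<kappa> * (real n * 2 ^ (n - 1) * (r1 + r2 - r))"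
          using \<kappa> by (intro mult_left_mono) auto
        also have "\<dots> = (r1 + r2 - r) / 3" using n by (simp add: \<kappa>_def)
        finally show "3 * h \<le> r1 + r2 - r" by (simp add: h_def algebra_simps)
      qed
      define \<tau> where "\<tau> = t powr ((real n + 1) / 2)"
      have \<tau>: "\<tau> > 0" "t * sqrt t ^ (n - 1) = \<tau>"
      proof -
        have "t * sqrt t ^ (n - 1) = t powr 1 * t powr ((real n - 1) / 2)"
        proof -
          have "sqrt t ^ (n - 1) = (t powr (1 / 2)) powr real (n - 1)"
            using t(1) by (simp add: powr_half_sqrt powr_realpow)
          then show ?thesis using t(1) n by (simp add: powr_powr of_nat_diff)
        qed
        also have "\<dots> = t powr (1 + (real n - 1) / 2)" by (simp only: powr_add)
        also have "1 + (real n - 1) / 2 = (real n + 1) / 2" by (simp add: field_simps)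
        finally show "t * sqrt t ^ (n - 1) = \<tau>" by (simp add: \<tau>_def)
      qed (use t(1) in \<open>simp add: \<tau>_def\<close>)
      have "K * h * sqrt (r2 * h) ^ (n - 1) = A * m2 * \<tau>"
      proof -
        have "sqrt (r2 * h) = r2 * (sqrt \<kappa> * sqrt t)"
          using rpos by (simp add: h_def real_sqrt_mult mult_ac)
        then have "K * h * sqrt (r2 * h) ^ (n - 1)
            = K * \<kappa> * sqrt \<kappa> ^ (n - 1) * (r2 * r2 ^ (n - 1)) * (t * sqrt t ^ (n - 1))"
          by (simp add: h_def power_mult_distrib mult_ac)
        also have "r2 * r2 ^ (n - 1) = r2 ^ n" using n by (simp flip: power_Suc)
        also note \<tau>(2)
        finally show ?thesis using \<omega> by (simp add: A_def vol)
      qed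
      moreover have "K * h * sqrt (r2 * h) ^ (n - 1) \<le> m * D + m1 * D1 + m2 * D2"
        using fraenkel_deficit_ge[OF lm pos sub disj, of h] r_le h
        by (simp add: cap_bound_def K_def n_def r_def r1_def r2_def m_def m1_def m2_def D_def D1_def D2_def)
      ultimately have deficit: "A * m2 * \<tau> \<le> m * D + m1 * D1 + m2 * D2" by simp
      define q where "q = A * m2 * \<tau> / 3"
      have q: "q > 0" using A mpos \<tau> by (simp add: q_def)
      from deficit consider "q \<le> m * D" | "q \<le> m1 * D1" | "q \<le> m2 * D2"
        unfolding q_def by linarith
      then have "m * (q / m) powr p \<le> m * D powr p + m1 * D1 powr p + m2 * D2 powr p"
      proof cases
        case 1
        then have "m * (q / m) powr p \<le> m * D powr p"
          using p q mpos by (intro mult_powr_ge) auto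
        moreover have "0 \<le> m1 * D1 powr p" "0 \<le> m2 * D2 powr p" using mpos by auto
        ultimately show ?thesis by linarith
      next
        case 2
        then have "m * (q / m) powr p \<le> m1 * D1 powr p"
          using p q mpos m12_le by (intro mult_powr_ge) auto
        moreover have "0 \<le> m * D powr p" "0 \<le> m2 * D2 powr p" using mpos by auto
        ultimately show ?thesis by linarith
      next
        case 3
        then have "m * (q / m) powr p \<le> m2 * D2 powr p"
          using p q mpos m12_le by (intro mult_powr_ge) auto
        moreover have "0 \<le> m * D powr p" "0 \<le> m1 * D1 powr p" using mpos by auto
        ultimately show ?thesis by linarith
      qed
      then have lower: "m * (q / m) powr p / (2 * m)
          \<le> (m * D powr p + m1 * D1 powr p + m2 * D2 powr p) / (m + (m1 + m2))"
        using mpos m12_le by (intro frac_le) auto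
      have "(r1 + r2) ^ n \<le> (2 * r1) ^ n" using rpos r_le by (intro power_mono) auto
      then have "S \<le> 2 ^ n * m1" using \<omega> by (simp add: S vol power_mult_distrib mult_ac)
      also have "\<dots> \<le> 2 ^ n * (m1 + m2)" using mpos by simp
      finally have m_le: "m \<le> 2 ^ n * (m1 + m2)" using mS by simp
      have "A / (3 * 2 ^ n) * (m2 / (m1 + m2)) * \<tau> = q / (2 ^ n * (m1 + m2))"
        by (simp add: q_def)
      also have "\<dots> \<le> q / m" using q m_le mpos by (intro divide_left_mono) auto
      finally have "(A / (3 * 2 ^ n) * (m2 / (m1 + m2)) * \<tau>) powr p \<le> (q / m) powr p"
        using A mpos \<tau> p by (intro powr_mono2) auto
      moreover have "(A / (3 * 2 ^ n) * (m2 / (m1 + m2)) * \<tau>) powr p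
          = (A / (3 * 2 ^ n)) powr p * (m2 / (m1 + m2)) powr p * \<tau> powr p"
        using A mpos \<tau> by (simp only: powr_mult)
      moreover have "\<tau> powr p = t powr (real n * (real n + 1) / (2 * (real n - 1)))"
        by (simp add: \<tau>_def powr_powr p_def mult_ac)
      ultimately have "C * (m2 / (m1 + m2)) powr p * t powr (real n * (real n + 1) / (2 * (real n - 1)))
          \<le> (q / m) powr p / 2" by (simp add: C_def)
      also have "(q / m) powr p / 2 = m * (q / m) powr p / (2 * m)" using mpos by simp
      finally show ?thesis using lower by linarith
    qed
    show "let n = real CARD('n);
           S = (measure lebesgue E1 powr (1 / n) + measure lebesgue E2 powr (1 / n)) ^ CARD('n)
       in
        (measure lebesgue E * fraenkel_asymmetry E powr (n / (n - 1))
         + measure lebesgue E1 * fraenkel_asymmetry E1 powr (n / (n - 1))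
         + measure lebesgue E2 * fraenkel_asymmetry E2 powr (n / (n - 1)))
        / (measure lebesgue E + measure lebesgue (E1 \<union> E2))
        \<ge> C * (measure lebesgue E2 / (measure lebesgue E1 + measure lebesgue E2)) powr (n / (n - 1))
          * (max 0 ((S - measure lebesgue E) / (S - measure lebesgue (E1 \<union> E2))))
              powr (n * (n + 1) / (2 * (n - 1)))"
      using main unfolding Let_def m12 t_def S_def D_def D1_def D2_def p_def n_def m_def m1_def m2_def .
  qed
qed

end
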